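(* Let $\mathcal{Q}=\{(x,y): x>0,\ y>0,\ x^2+y^2=1\}$ and let $\overline{\mathcal Q}$ be its closure. Define $T:\mathcal{Q}\to\overline{\mathcal{Q}}$ by $$T(x,y)=\left(\frac{|2-x-2y|}{3-2x-2y},\ \frac{|2-2x-y|}{3-2x-2y}\right),$$ and define $d:\mathcal{Q}\to\{1,2,3,oe,eo\}$ by $$d(x,y)=\begin{cases}1 & \text{if } x/y>4/3,\\ 2 & \text{if } 3/4<x/y<4/3,\\ 3 & \text{if } x/y<3/4,\\ oe & \text{if } (x,y)=(3/5,4/5),\\ eo & \text{if } (x,y)=(4/5,3/5).\end{cases}$$ Then: (i) If $(x,y)=(a/c,b/c)\in\mathcal{Q}\cap\mathbb{Q}^2$ is a rational point of $\mathcal{Q}$ with $a/c,\ b/c$ in lowest terms (so that $(a,b,c)$ is a primitive Pythagorean triple), then for some $n\ge 0$ the iterate $T^{n+1}(x,y)$ is equal to $(1,0)$ or $(0,1)$, and if we define $d_k=d(T^{k-1}(x,y))$ for $k=1,2,\ldots,n+1$, then $(d_1,d_2,\ldots,d_{n+1})$ is the ternary expansion (with last digit in $\{oe,eo\}$) of the primitive Pythagorean triple $(a,b,c)$. (ii) If $(x,y)\in\mathcal{Q}$ is an irrational point (i.e. $(x,y)\notin\mathbb{Q}^2$), then $T^n(x,y)\in\mathcal{Q}$ for all $n\ge 0$, and the sequence $d_k=d(T^{k-1}(x,y))$, $k\ge 1$, is an infinite sequence over the alphabet $\{1,2,3\}$ which does not terminate with an infinite succession of $1$'s or with an infinite succession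 of $3$'s. (iii) For any sequence $(d_k)_{k\ge 1}$ over the alphabet $\{1,2,3\}$ which does not terminate with an infinite succession of $1$'s or an infinite succession of $3$'s, there is a unique point $(x,y)\in\mathcal{Q}$ such that $d_k=d(T^{k-1}(x,y))$ for all $k\ge 1$, and this point is irrational.
   Context: A primitive Pythagorean triple (PPT) is a triple $(a,b,c)$ of positive integers with $\gcd(a,b)=1$ and $a^2+b^2=c^2$; exactly one of $a,b$ is odd. Let $$M_1=\begin{pmatrix}-1&2&2\\-2&1&2\\-2&2&3\end{pmatrix},\quad M_2=\begin{pmatrix}1&2&2\\2&1&2\\2&2&3\end{pmatrix},\quad M_3=\begin{pmatrix}1&-2&2\\2&-1&2\\2&-2&3\end{pmatrix}.$$ By a theorem of Barning, every PPT $(a,b,c)$ with $a$ odd and $b$ even has a unique representation $(a,b,c)^{t}=M_{d_1}M_{d_2}\cdots M_{d_n}(3,4,5)^{t}$, and every PPT with $a$ even and $b$ odd has a unique representation $(a,b,c)^{t}=M_{d_1}M_{d_2}\cdots M_{d_n}(4,3,5)^{t}$, with $n\ge0$ and $(d_1,\ldots,d_n)\in\{1,2,3\}^n$. The ternary expansion of the PPT $(a,b,c)$ is the sequence $(d_1,\ldots,d_n,d_{n+1})$, where $d_1,\ldots,d_n$ are these indices and the final digit is $d_{n+1}=oe$ if $a$ is odd and $b$ even, and $d_{n+1}=eo$ if $a$ is even and $b$ odd. $T^k$ denotes the $k$-th iterate of $T$ (with $T^0$ the identity), defined as long as the previous iterates lie in $\mathcal{Q}$. *)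

theory Defs
  imports "HOL-Analysis.Analysis"
begin

definition quarter_circle :: "(real \<times> real) set" where
  "quarter_circle = {(x, y). x > 0 \<and> y > 0 \<and> x\<^sup>2 + y\<^sup>2 = 1}"

text \<open>
  The maps \<open>T\<close> and \<open>digit_of\<close> below are only meant on \<^const>\<open>quarter_circle\<close>. As HOL functions
  they are total (for instance, \<open>T\<close> fixes the two end points of the arc), so a statement about
  \<open>T\<^sup>k\<close> has to say separately that the earlier iterates lie in \<^const>\<open>quarter_circle\<close>.
\<close>

definition T :: "real \<times> real \<Rightarrow> real \<times> real" where
  "T = (\<lambda>(x, y). (\<bar>2 - x - 2 * y\<bar> / (3 - 2 * x - 2 * y), \<bar>2 - 2 * x - y\<bar> / (3 - 2 * x - 2 * y)))"

datatype index = I1 | I2 | I3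

datatype digit = Idx index | OE | EO

text \<open>On \<^const>\<open>quarter_circle\<close> the five conditions are mutually exclusive and exhaustive.\<close>

definition digit_of :: "real \<times> real \<Rightarrow> digit" where
  "digit_of = (\<lambda>(x, y).
     if x / y > 4 / 3 then Idx I1
     else if 3 / 4 < x / y \<and> x / y < 4 / 3 then Idx I2
     else if x / y < 3 / 4 then Idx I3
     else if (x, y) = (3 / 5, 4 / 5) then OE
     else if (x, y) = (4 / 5, 3 / 5) then EO
     else undefined)"

definition primitive_pythagorean_triple :: "int \<Rightarrow> int \<Rightarrow> int \<Rightarrow> bool" where
  "primitive_pythagorean_triple a b c \<longleftrightarrow>
     a > 0 \<and> b > 0 \<and> c > 0 \<and> coprime a b \<and> a\<^sup>2 + b\<^sup>2 = c\<^sup>2"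

fun M :: "index \<Rightarrow> int ^ 3 ^ 3" where
  "M I1 = vector [vector [-1, 2, 2], vector [-2, 1, 2], vector [-2, 2, 3]]"
| "M I2 = vector [vector [1, 2, 2], vector [2, 1, 2], vector [2, 2, 3]]"
| "M I3 = vector [vector [1, -2, 2], vector [2, -1, 2], vector [2, -2, 3]]"

definition M_prod :: "index list \<Rightarrow> int ^ 3 ^ 3" where
  "M_prod ds = foldr (\<lambda>i A. M i ** A) ds (mat 1)"

definition represents :: "digit list \<Rightarrow> int \<Rightarrow> int \<Rightarrow> int \<Rightarrow> bool" where
  "represents w a b c \<longleftrightarrow>
     (\<exists>ds. (odd a \<and> even b \<and> w = map Idx ds @ [OE] \<and>
            vector [a, b, c] = M_prod ds *v vector [3, 4, 5])
         \<or> (even a \<and> odd b \<and> w = map Idx ds @ [EO] \<and>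
            vector [a, b, c] = M_prod ds *v vector [4, 3, 5]))"

text \<open>
  By Barning's theorem every primitive Pythagorean triple is represented by exactly one word, its
  ternary expansion. Uniqueness is part of the following predicate, so that it expresses
  ``\<open>w\<close> is \<^emph>\<open>the\<close> ternary expansion of \<open>(a, b, c)\<close>'' without presupposing that theorem.
\<close>

definition is_ternary_expansion :: "digit list \<Rightarrow> int \<Rightarrow> int \<Rightarrow> int \<Rightarrow> bool" where
  "is_ternary_expansion w a b c \<longleftrightarrow>
     represents w a b c \<and> (\<forall>w'. represents w' a b c \<longrightarrow> w' = w)"

definition ends_in :: "index \<Rightarrow> (nat \<Rightarrow> index) \<Rightarrow> bool" where
  "ends_in i s \<longleftrightarrow> (\<exists>N. \<forall>k\<ge>N. s k = i)"

lemma T_denominator_pos: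
  assumes "(x, y) \<in> quarter_circle"
  shows "3 - 2 * x - 2 * y > 0"
proof -
  have "x\<^sup>2 + y\<^sup>2 = 1" using assms by (simp add: quarter_circle_def)
  moreover have "(x - y)\<^sup>2 \<ge> 0" by simp
  ultimately have "(x + y)\<^sup>2 \<le> 2" by (simp add: power2_eq_square algebra_simps)
  also have "\<dots> < (3 / 2 :: real)\<^sup>2" by (simp add: power2_eq_square)
  finally have "x + y < 3 / 2" using power_less_imp_less_base by fastforce
  then show ?thesis by simp
qed

lemma closure_quarter_circle:
  "closure quarter_circle = {(x, y). x \<ge> 0 \<and> y \<ge> 0 \<and> x\<^sup>2 + y\<^sup>2 = 1}" (is "_ = ?R")
proof
  have eq: "?R = {p. 0 \<le> fst p} \<inter> {p. 0 \<le> snd p} \<inter> {p. (fst p)\<^sup>2 + (snd p)\<^sup>2 = 1}"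
    by auto
  have "closed ?R" unfolding eq
    by (intro closed_Int closed_Collect_le closed_Collect_eq continuous_intros)
  then show "closure quarter_circle \<subseteq> ?R"
    by (rule closure_minimal[rotated]) (auto simp: quarter_circle_def)
  define t where "t = (\<lambda>n. inverse (real (Suc n)))"
  have t0: "t \<longlonglongrightarrow> 0" unfolding t_def by (rule LIMSEQ_inverse_real_of_nat)
  have t: "0 < t n" "t n < pi / 2" for n
  proof -
    show "0 < t n" by (simp add: t_def)
    have "t n \<le> 1" by (simp add: t_def field_simps)
    then show "t n < pi / 2" using pi_gt3 by simp
  qed
  have cs: "0 < cos (t n)" "0 < sin (t n)" for n
    using t[of n] by (auto intro!: cos_gt_zero sin_gt_zero)
  have "(\<lambda>n. (cos (t n), sin (t n))) \<longlonglongrightarrow> (cos 0, sin 0)"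
    by (intro tendsto_intros t0)
  moreover have "(cos (t n), sin (t n)) \<in> quarter_circle" for n
    using cs[of n] by (simp add: quarter_circle_def)
  ultimately have c1: "(1, 0) \<in> closure quarter_circle"
    unfolding closure_sequential by (intro exI[of _ "\<lambda>n. (cos (t n), sin (t n))"]) simp
  have "(\<lambda>n. (sin (t n), cos (t n))) \<longlonglongrightarrow> (sin 0, cos 0)"
    by (intro tendsto_intros t0)
  moreover have "(sin (t n), cos (t n)) \<in> quarter_circle" for n
    using cs[of n] by (simp add: quarter_circle_def)
  ultimately have c2: "(0, 1) \<in> closure quarter_circle"
    unfolding closure_sequential by (intro exI[of _ "\<lambda>n. (sin (t n), cos (t n))"]) simp
  show "?R \<subseteq> closure quarter_circle"
  proof clarify
    fix x y :: real
    assume a: "0 \<le> x" "0 \<le> y" "x\<^sup>2 + y\<^sup>2 = 1"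
    consider "x = 0" | "y = 0" | "0 < x" "0 < y" using a by linarith
    then show "(x, y) \<in> closure quarter_circle"
    proof cases
      case 1
      then have "y = 1" using a by (simp add: power2_eq_1_iff)
      then show ?thesis using 1 c2 by simp
    next
      case 2
      then have "x = 1" using a by (simp add: power2_eq_1_iff)
      then show ?thesis using 2 c1 by simp
    next
      case 3
      then show ?thesis using a closure_subset[of quarter_circle]
        by (auto simp: quarter_circle_def)
    qed
  qed
qed

lemma T_maps_to_closure: "T ` quarter_circle \<subseteq> closure quarter_circle"
proof (rule image_subsetI, clarify)
  fix x y :: real
  assume p: "(x, y) \<in> quarter_circle"
  define D where "D = 3 - 2 * x - 2 * y"
  have D: "D > 0" using T_denominator_pos[OF p] by (simp add: D_def)
  have xy: "x\<^sup>2 + y\<^sup>2 = 1" using p by (simp add: quarter_circle_def)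
  have "(2 - x - 2 * y)\<^sup>2 + (2 - 2 * x - y)\<^sup>2 - D\<^sup>2 = x\<^sup>2 + y\<^sup>2 - 1"
    by (simp add: D_def power2_eq_square algebra_simps)
  then have "(2 - x - 2 * y)\<^sup>2 + (2 - 2 * x - y)\<^sup>2 = D\<^sup>2" using xy by simp
  then have "(\<bar>2 - x - 2 * y\<bar> / D)\<^sup>2 + (\<bar>2 - 2 * x - y\<bar> / D)\<^sup>2 = 1"
    using D by (simp add: power_divide add_divide_distrib[symmetric])
  then show "T (x, y) \<in> closure quarter_circle"
    using D by (simp add: closure_quarter_circle T_def D_def)
qed

end

theory Submission
  imports Defs
begin

text \<open>
  The map \<open>T\<close> is Barning's descent read projectively. On the isotropic cone
  \<open>a\<^sup>2 + b\<^sup>2 = c\<^sup>2\<close> the inverse of each of the three matrices sends a triple to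
  \<open>(\<plusminus>(a + 2b - 2c), \<plusminus>(2a + b - 2c), 3c - 2a - 2b)\<close>, and only the signs depend on the matrix. The
  absolute values in \<open>T\<close> choose the signs that make the image positive, and the digit records the
  choice. Hence applying the \<open>i\<close>-th matrix and normalising is a right inverse of \<open>T\<close> whose
  values have digit \<open>i\<close> (\<open>T_child\<close>, \<open>digit_of_child\<close>).

  \<^emph>\<open>Rational points.\<close> The descent strictly decreases the hypotenuse of a primitive
  triple and can only stop at \<open>(3, 4, 5)\<close> or \<open>(4, 3, 5)\<close>, so every primitive triple has at least
  one word (\<open>ternary_word_exists\<close>). Any word of a triple can be read off from the \<open>T\<close>-orbit of
  its point, up to the first digit that is not an index, so there is at most one
  (\<open>represents_unique\<close>). In particular the orbit of a rational point leaves the open arc.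

  \<^emph>\<open>Irrational points.\<close> In the half-angle coordinate \<open>u = y / (1 + x)\<close> the arc is the unit
  interval and the inverse branches of \<open>T\<close> are the Moebius maps \<open>v / (1 + 2v)\<close>, \<open>1 / (2 + v)\<close> and
  \<open>1 / (2 - v)\<close>, whose images fill the interval up to the two points \<open>1/3\<close> and \<open>1/2\<close>. A point
  with an infinite digit sequence is therefore the start of an infinite backward chain
  \<open>u\<^sub>k = branch (s\<^sub>k) (u\<^sub>k\<^sub>+\<^sub>1)\<close>, called an itinerary below. The first and the third branch
  have the neutral fixed points \<open>0\<close> and \<open>1\<close>; while their digit is repeated, \<open>1 / u\<close> and
  \<open>1 / (1 - u)\<close> respectively lose a fixed positive amount at each step. They are positive, so an
  itinerary cannot end in such a constant tail (\<open>itinerary_not_ends_in\<close>).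

  \<^emph>\<open>Existence and uniqueness of the point with given digits.\<close> Compactness gives an itinerary
  in the closed interval, and it can touch an end point only if the sequence has a forbidden tail
  (\<open>itinerary_exists\<close>). For uniqueness, branches are monotone, so everything between
  two points with the same infinite digit sequence shares that sequence. A rational number lies
  between any two distinct points, but the orbit of a rational point leaves the arc
  (\<open>itinerary_unique\<close>).
\<close>

section \<open>Barning's maps on triples and on the arc\<close>

text \<open>
  The three matrices act here on triples over an arbitrary ring, so that the same maps serve
  integer triples and the real triples that represent points of the arc.
\<close>

fun child :: "index \<Rightarrow> 'a::comm_ring_1 \<times> 'a \<times> 'a \<Rightarrow> 'a \<times> 'a \<times> 'a" where
  "child I1 (a, b, c) = (- a + 2 * b + 2 * c, - 2 * a + b + 2 * c, - 2 * a + 2 * b + 3 * c)"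
| "child I2 (a, b, c) = (a + 2 * b + 2 * c, 2 * a + b + 2 * c, 2 * a + 2 * b + 3 * c)"
| "child I3 (a, b, c) = (a - 2 * b + 2 * c, 2 * a - b + 2 * c, 2 * a - 2 * b + 3 * c)"

definition right_triple :: "'a::linordered_idom \<times> 'a \<times> 'a \<Rightarrow> bool" where
  "right_triple = (\<lambda>(a, b, c). a > 0 \<and> b > 0 \<and> c > 0 \<and> a\<^sup>2 + b\<^sup>2 = c\<^sup>2)"

definition normalise :: "real \<times> real \<times> real \<Rightarrow> real \<times> real" where
  "normalise = (\<lambda>(a, b, c). (a / c, b / c))"

definition real_triple :: "int \<times> int \<times> int \<Rightarrow> real \<times> real \<times> real" where
  "real_triple = (\<lambda>(a, b, c). (of_int a, of_int b, of_int c))"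

lemma right_triple_ineqs:
  assumes "right_triple (a, b, c)"
  shows "a < c" "b < c" "c < a + b"
proof -
  have *: "a > 0" "b > 0" "c > 0" "a\<^sup>2 + b\<^sup>2 = c\<^sup>2"
    using assms by (auto simp: right_triple_def)
  have "a\<^sup>2 < c\<^sup>2" "b\<^sup>2 < c\<^sup>2"
    using * by (metis less_add_same_cancel1 zero_less_power, metis less_add_same_cancel2 zero_less_power)
  then show "a < c" "b < c"
    using * by (meson less_imp_le power_less_imp_less_base)+
  have "0 < a * b" using * by simp
  then have "c\<^sup>2 < (a + b)\<^sup>2"
    using * by (simp add: power2_sum)
  then show "c < a + b"
    using * by (meson add_pos_pos less_imp_le power_less_imp_less_base)
qed

lemma right_triple_child:
  assumes "right_triple t"
  shows "right_triple (child i t)"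
proof -
  obtain a b c where t: "t = (a, b, c)" by (cases t)
  have *: "a > 0" "b > 0" "c > 0" "a\<^sup>2 + b\<^sup>2 = c\<^sup>2" "a < c" "b < c"
    using assms right_triple_ineqs[of a b c] by (auto simp: right_triple_def t)
  show ?thesis
    using * unfolding t
    by (cases i) (auto simp: right_triple_def power2_eq_square algebra_simps)
qed

lemma normalise_in_quarter_circle:
  assumes "right_triple t"
  shows "normalise t \<in> quarter_circle"
  using assms
  by (auto simp: right_triple_def normalise_def quarter_circle_def power_divide
      simp flip: add_divide_distrib)

text \<open>
  The conditions on \<open>x / y\<close> are conditions on the signs of \<open>a + 2b - 2c\<close> and \<open>2a + b - 2c\<close>, but they
  are checked directly: for a child with legs \<open>a'\<close>, \<open>b'\<close>, the numbers \<open>3a' - 4b'\<close> and \<open>4a' - 3b'\<close>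
  are linear in \<open>a, b, c\<close>, and the triangle inequalities decide their signs.
\<close>

lemma digit_of_child:
  assumes "right_triple t"
  shows "digit_of (normalise (child i t)) = Idx i"
proof -
  obtain a b c where t: "t = (a, b, c)" by (cases t)
  have *: "a > 0" "b > 0" "c > 0" "a < c" "b < c" "c < a + b"
    using assms right_triple_ineqs[of a b c] by (auto simp: right_triple_def t)
  obtain a' b' c' where t': "child i t = (a', b', c')" by (cases "child i t")
  have pos: "a' > 0" "b' > 0" "c' > 0"
    using right_triple_child[OF assms, of i] by (auto simp: right_triple_def t')
  have q: "(a' / c') / (b' / c') = a' / b'"
    using pos by simp
  have "case i of I1 \<Rightarrow> 4 * b' < 3 * a' | I2 \<Rightarrow> 3 * b' < 4 * a' \<and> 3 * a' < 4 * b'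
    | I3 \<Rightarrow> 4 * a' < 3 * b'"
    using t' * unfolding t by (cases i) auto
  then show ?thesis
    using pos unfolding t' normalise_def digit_of_def prod.case q
    by (cases i) (auto simp: field_simps)
qed

lemma T_child:
  assumes "right_triple t"
  shows "T (normalise (child i t)) = normalise t"
proof -
  obtain a b c where t: "t = (a, b, c)" by (cases t)
  have *: "a > 0" "b > 0" "c > 0"
    using assms by (auto simp: right_triple_def t)
  obtain a' b' c' where t': "child i t = (a', b', c')" by (cases "child i t")
  have pos: "c' > 0"
    using right_triple_child[OF assms, of i] by (auto simp: right_triple_def t')
  have inv: "\<bar>2 * c' - a' - 2 * b'\<bar> = a" "\<bar>2 * c' - 2 * a' - b'\<bar> = b" "3 * c' - 2 * a' - 2 * b' = c"
    using t' * unfolding t by (cases i; auto)+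
  have frac: "2 - a' / c' - 2 * (b' / c') = (2 * c' - a' - 2 * b') / c'"
    "2 - 2 * (a' / c') - b' / c' = (2 * c' - 2 * a' - b') / c'"
    "3 - 2 * (a' / c') - 2 * (b' / c') = (3 * c' - 2 * a' - 2 * b') / c'"
    using pos by (simp_all add: field_simps)
  show ?thesis
    using pos * unfolding t' unfolding t normalise_def T_def prod.case frac abs_divide inv
    by simp
qed

section \<open>Words of Pythagorean triples\<close>

abbreviation vec_of :: "int \<times> int \<times> int \<Rightarrow> int ^ 3" where
  "vec_of \<equiv> \<lambda>(a, b, c). vector [a, b, c]"

lemma vec_of_eq_iff: "vec_of t = vec_of t' \<longleftrightarrow> t = t'"
  by (auto simp: vec_eq_iff forall_3 vector_3 split: prod.splits)

lemma M_mult_vec: "M i *v vec_of t = vec_of (child i t)"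
  by (cases t; cases i)
     (simp_all add: vec_eq_iff forall_3 matrix_vector_mult_def sum_3 vector_3)

text \<open>
  The bridge from matrix words to iterated \<^const>\<open>child\<close> maps.
\<close>

lemma M_prod_mult_vec: "M_prod ds *v vec_of t = vec_of (foldr child ds t)"
proof (induction ds)
  case Nil
  then show ?case by (simp add: M_prod_def)
next
  case (Cons i ds)
  have "M_prod (i # ds) *v vec_of t = M i *v (M_prod ds *v vec_of t)"
    by (simp add: M_prod_def matrix_vector_mul_assoc)
  then show ?case
    using Cons by (simp add: M_mult_vec)
qed

lemma represents_iff:
  "represents w a b c \<longleftrightarrow>
    (\<exists>ds. (odd a \<and> even b \<and> w = map Idx ds @ [OE] \<and> (a, b, c) = foldr child ds (3, 4, 5))
        \<or> (even a \<and> odd b \<and> w = map Idx ds @ [EO] \<and> (a, b, c) = foldr child ds (4, 3, 5)))"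
proof -
  have "vector [a, b, c] = M_prod ds *v vector [x, y, z] \<longleftrightarrow> (a, b, c) = foldr child ds (x, y, z)"
    for ds x y z
    using M_prod_mult_vec[of ds "(x, y, z)"] vec_of_eq_iff[of "(a, b, c)" "foldr child ds (x, y, z)"]
    by simp
  then show ?thesis
    by (simp add: represents_def)
qed

lemma represents_Cons:
  assumes "represents w a b c" "child i (a, b, c) = (a', b', c')"
  shows "represents (Idx i # w) a' b' c'"
proof -
  have par: "even a' \<longleftrightarrow> even a" "even b' \<longleftrightarrow> even b"
    using assms(2) by (cases i; auto)+
  from assms(1) obtain ds z e where ds: "w = map Idx ds @ [e]" "(a, b, c) = foldr child ds z"
    "odd a \<and> even b \<and> e = OE \<and> z = (3, 4, 5) \<or> even a \<and> odd b \<and> e = EO \<and> z = (4, 3, 5)"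
    unfolding represents_iff by blast
  have "Idx i # w = map Idx (i # ds) @ [e]" "(a', b', c') = foldr child (i # ds) z"
    using ds assms(2) by (simp_all flip: ds(2))
  then show ?thesis
    using ds(3) par unfolding represents_iff by blast
qed

text \<open>
  With \<open>p\<close>, \<open>q\<close>, \<open>r\<close> the (signed) preimage, \<open>\<bar>p\<bar>\<close>, \<open>\<bar>q\<bar>\<close>, \<open>r\<close> is again a primitive triple and
  \<open>r < c\<close> because \<open>c < a + b\<close>. A leg vanishes only if the legs are in proportion \<open>3 : 4\<close>. The signs
  of \<open>p\<close> and \<open>q\<close> select the matrix, and both negative is impossible: it would give \<open>c > a + b\<close>.
\<close>

lemma pythagorean_descent:
  assumes "primitive_pythagorean_triple a b c" "(a, b, c) \<noteq> (3, 4, 5)" "(a, b, c) \<noteq> (4, 3, 5)"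
  obtains i a' b' c' where "child i (a', b', c') = (a, b, c)"
    "primitive_pythagorean_triple a' b' c'" "c' < c"
proof -
  have ppt: "a > 0" "b > 0" "c > 0" "coprime a b" "a\<^sup>2 + b\<^sup>2 = c\<^sup>2"
    using assms(1) by (auto simp: primitive_pythagorean_triple_def)
  then have less: "a < c" "b < c" "c < a + b"
    using right_triple_ineqs[of a b c] by (auto simp: right_triple_def)
  define p q r where "p = a + 2 * b - 2 * c" and "q = 2 * a + b - 2 * c" and "r = 3 * c - 2 * a - 2 * b"
  have pqr: "p\<^sup>2 + q\<^sup>2 = r\<^sup>2"
    using ppt(5) by (simp add: p_def q_def r_def power2_eq_square algebra_simps)
  have inv: "a = p + 2 * q + 2 * r" "b = 2 * p + q + 2 * r" "c = 2 * p + 2 * q + 3 * r"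
    by (simp_all add: p_def q_def r_def)
  have ratio: "a = m \<and> b = n \<and> c = 5" if "n * a = m * b" "coprime m n" "m > 0" "n > 0" "m\<^sup>2 + n\<^sup>2 = 25" for m n
  proof -
    have "a dvd m" "m dvd a"
      using that ppt(4) by (metis coprime_dvd_mult_left_iff dvd_triv_right,
        metis coprime_dvd_mult_right_iff dvd_triv_left)
    then have "a = m" using ppt that zdvd_antisym_nonneg by simp
    moreover have "b = n" using that \<open>a = m\<close> by (simp add: mult.commute)
    ultimately have "c\<^sup>2 = 5\<^sup>2" using ppt that by simp
    then have "c = 5" using ppt(3) power2_eq_iff_nonneg[of c 5] by simp
    then show ?thesis using \<open>a = m\<close> \<open>b = n\<close> by simp
  qed
  have "p \<noteq> 0"
  proof
    assume "p = 0"
    then have "a\<^sup>2 + b\<^sup>2 = c\<^sup>2" "a = 2 * (c - b)" using ppt by (auto simp: p_def)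
    then have "(c - b) * (3 * a) = (c - b) * (4 * b)"
      by algebra
    then have "3 * a = 4 * b" using less by simp
    then show False using ratio[where m = 4 and n = 3] coprime_add_one_left[of "3::int"] assms(3) by simp
  qed
  have "q \<noteq> 0"
  proof
    assume "q = 0"
    then have "a\<^sup>2 + b\<^sup>2 = c\<^sup>2" "b = 2 * (c - a)" using ppt by (auto simp: q_def)
    then have "(c - a) * (4 * a) = (c - a) * (3 * b)"
      by algebra
    then have "4 * a = 3 * b" using less by simp
    then show False using ratio[where m = 3 and n = 4] coprime_add_one_right[of "3::int"] assms(2) by simp
  qed
  \<comment> \<open>The legs of a right triangle satisfy \<open>(a + b)\<^sup>2 \<le> 2 c\<^sup>2\<close>, and \<open>8 < 9\<close>.\<close>
  have r: "r > 0"
  proof (rule ccontr)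
    assume "\<not> r > 0"
    then have "3 * c \<le> 2 * (a + b)" by (simp add: r_def)
    then have "(3 * c)\<^sup>2 \<le> (2 * (a + b))\<^sup>2"
      using ppt by (intro power_mono) auto
    moreover have "(a + b)\<^sup>2 \<le> 2 * c\<^sup>2"
      using zero_le_power2[of "a - b"] ppt(5) by (simp add: power2_eq_square algebra_simps)
    moreover have "(3 * c)\<^sup>2 = 9 * c\<^sup>2" "(2 * (a + b))\<^sup>2 = 4 * (a + b)\<^sup>2"
      by (simp_all only: power_mult_distrib) simp_all
    moreover have "c\<^sup>2 > 0" using ppt(3) by simp
    ultimately show False by linarith
  qed
  \<comment> \<open>A common divisor of \<open>p\<close> and \<open>q\<close> divides \<open>r\<close>, hence the integer combinations \<open>a\<close> and \<open>b\<close>.\<close>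
  have cop: "coprime \<bar>p\<bar> \<bar>q\<bar>"
  proof -
    have "is_unit d" if d: "d dvd p" "d dvd q" for d
    proof -
      have "d\<^sup>2 dvd r\<^sup>2" using d by (auto simp flip: pqr)
      then have "d dvd r" by simp
      then have "d dvd a" "d dvd b" using d unfolding inv by auto
      then show ?thesis using ppt(4) by (meson coprime_common_divisor)
    qed
    then show ?thesis by (auto intro: coprimeI)
  qed
  have ppt': "primitive_pythagorean_triple \<bar>p\<bar> \<bar>q\<bar> r"
    using \<open>p \<noteq> 0\<close> \<open>q \<noteq> 0\<close> r cop pqr by (simp add: primitive_pythagorean_triple_def)
  have "r < c" using less by (simp add: r_def)
  have "r < \<bar>p\<bar> + \<bar>q\<bar>"
    using right_triple_ineqs(3)[of "\<bar>p\<bar>" "\<bar>q\<bar>" r] \<open>p \<noteq> 0\<close> \<open>q \<noteq> 0\<close> r pqr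
    by (simp add: right_triple_def)
  then have "\<not> (p < 0 \<and> q < 0)"
    using less(3) unfolding p_def q_def r_def by linarith
  then consider "p < 0" "q > 0" | "p > 0" "q > 0" | "p > 0" "q < 0"
    using \<open>p \<noteq> 0\<close> \<open>q \<noteq> 0\<close> by linarith
  then show ?thesis
  proof cases
    case 1
    then have "child I1 (\<bar>p\<bar>, \<bar>q\<bar>, r) = (a, b, c)" using inv by simp
    then show ?thesis using that ppt' \<open>r < c\<close> by blast
  next
    case 2
    then have "child I2 (\<bar>p\<bar>, \<bar>q\<bar>, r) = (a, b, c)" using inv by simp
    then show ?thesis using that ppt' \<open>r < c\<close> by blast
  next
    case 3
    then have "child I3 (\<bar>p\<bar>, \<bar>q\<bar>, r) = (a, b, c)" using inv by simp
    then show ?thesis using that ppt' \<open>r < c\<close> by blast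
  qed
qed

lemma ternary_word_exists:
  assumes "primitive_pythagorean_triple a b c"
  shows "\<exists>w. represents w a b c"
  using assms
proof (induction "nat c" arbitrary: a b c rule: less_induct)
  case less
  consider "(a, b, c) = (3, 4, 5)" | "(a, b, c) = (4, 3, 5)"
    | "(a, b, c) \<noteq> (3, 4, 5)" "(a, b, c) \<noteq> (4, 3, 5)" by blast
  then show ?case
  proof cases
    case 1
    then have "represents [OE] a b c"
      unfolding represents_iff by (intro exI[of _ "[]"]) simp
    then show ?thesis ..
  next
    case 2
    then have "represents [EO] a b c"
      unfolding represents_iff by (intro exI[of _ "[]"]) simp
    then show ?thesis ..
  next
    case 3
    obtain i a' b' c' where d: "child i (a', b', c') = (a, b, c)"
      "primitive_pythagorean_triple a' b' c'" "c' < c"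
      using pythagorean_descent[OF less.prems 3] .
    have "nat c' < nat c"
      using d(2,3) by (simp add: primitive_pythagorean_triple_def)
    then obtain w where "represents w a' b' c'"
      using less.hyps d(2) by blast
    then show ?thesis
      using represents_Cons d(1) by blast
  qed
qed

lemma real_triple_child: "real_triple (child i t) = child i (real_triple t)"
  by (cases t; cases i) (simp_all add: real_triple_def)

lemma right_triple_real_triple: "right_triple (real_triple t) \<longleftrightarrow> right_triple t"
  by (cases t) (auto simp: right_triple_def real_triple_def simp flip: of_int_power of_int_add)

lemma right_triple_foldr_child: "right_triple t \<Longrightarrow> right_triple (foldr child ds t)"
  by (induction ds) (auto intro: right_triple_child)

text \<open>
  Since \<open>T\<close> undoes one \<^const>\<open>child\<close> at a time and the digit reports which one, the orbit of the point
  spells the word \<open>ds\<close>. This holds from any starting triple \<open>t\<close>.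
\<close>

lemma foldr_child_orbit:
  fixes t :: "real \<times> real \<times> real"
  assumes "right_triple t"
  defines "p \<equiv> \<lambda>ds. normalise (foldr child ds t)"
  shows "(T ^^ length ds) (p ds) = normalise t"
    and "k \<le> length ds \<Longrightarrow> (T ^^ k) (p ds) \<in> quarter_circle"
    and "k < length ds \<Longrightarrow> digit_of ((T ^^ k) (p ds)) = Idx (ds ! k)"
proof -
  have step: "T (p (i # ds)) = p ds" "digit_of (p (i # ds)) = Idx i" "p ds \<in> quarter_circle" for i ds
    using T_child digit_of_child normalise_in_quarter_circle right_triple_foldr_child[OF assms(1)]
    by (simp_all add: p_def)
  have iter: "(T ^^ Suc k) (p (i # ds)) = (T ^^ k) (p ds)" for i ds k
    by (simp only: funpow_Suc_right comp_apply step)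
  show "(T ^^ length ds) (p ds) = normalise t"
  proof (induction ds)
    case Nil
    then show ?case by (simp add: p_def)
  next
    case (Cons i ds)
    then show ?case using iter by simp
  qed
  show "k \<le> length ds \<Longrightarrow> (T ^^ k) (p ds) \<in> quarter_circle"
  proof (induction ds arbitrary: k)
    case Nil
    then show ?case using step by simp
  next
    case (Cons i ds)
    then show ?case
      by (cases k) (simp_all add: step iter del: funpow.simps(2))
  qed
  show "k < length ds \<Longrightarrow> digit_of ((T ^^ k) (p ds)) = Idx (ds ! k)"
  proof (induction ds arbitrary: k)
    case Nil
    then show ?case by simp
  next
    case (Cons i ds)
    then show ?case
      by (cases k) (simp_all add: step iter del: funpow.simps(2))
  qed
qed

text \<open>
  The last two conclusions locate the end of the word inside the digit sequence of the orbit, which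
  does not mention the word; this is what makes the word unique.
\<close>

lemma represents_orbit:
  assumes "represents w a b c"
  defines "p \<equiv> (of_int a / of_int c, of_int b / of_int c)"
  obtains n where "\<forall>k\<le>n. (T ^^ k) p \<in> quarter_circle"
    "(T ^^ (n + 1)) p \<in> {(1, 0), (0, 1)}"
    "w = map (\<lambda>k. digit_of ((T ^^ k) p)) [0..<n + 1]"
    "\<forall>k<n. \<exists>i. digit_of ((T ^^ k) p) = Idx i" "digit_of ((T ^^ n) p) \<in> {OE, EO}"
proof -
  obtain ds z e where ds: "w = map Idx ds @ [e]" "(a, b, c) = foldr child ds z"
    and z: "e = OE \<and> z = (3, 4, 5) \<or> e = EO \<and> z = (4, 3, 5)"
    using assms(1) unfolding represents_iff by blast
  define t where "t = real_triple z"
  have t: "right_triple t"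
    using z unfolding t_def right_triple_real_triple by (auto simp: right_triple_def)
  have "real_triple (foldr child ds z) = foldr child ds t"
    by (induction ds) (simp_all add: t_def real_triple_child)
  then have p: "p = normalise (foldr child ds t)"
    by (simp add: p_def real_triple_def normalise_def flip: ds(2) \<open>real_triple (foldr child ds z) = _\<close>)
  note orbit = foldr_child_orbit[OF t, where ds = ds, folded p]
  have top: "(T ^^ length ds) p = normalise t"
    using foldr_child_orbit(1)[OF t, of ds] by (simp add: p)
  have e: "digit_of (normalise t) = e" "e \<in> {OE, EO}" "T (normalise t) \<in> {(1, 0), (0, 1)}"
    using z by (auto simp: t_def real_triple_def normalise_def digit_of_def T_def)
  show ?thesis
  proof (rule that)
    show "\<forall>k\<le>length ds. (T ^^ k) p \<in> quarter_circle" using orbit by simp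
    show "(T ^^ (length ds + 1)) p \<in> {(1, 0), (0, 1)}" using top e by simp
    show "w = map (\<lambda>k. digit_of ((T ^^ k) p)) [0..<length ds + 1]"
      using orbit(3) top e by (intro nth_equalityI) (auto simp: ds(1) nth_append less_Suc_eq)
    show "\<forall>k<length ds. \<exists>i. digit_of ((T ^^ k) p) = Idx i" using orbit(3) by blast
    show "digit_of ((T ^^ length ds) p) \<in> {OE, EO}" using top e by simp
  qed
qed

lemma represents_unique:
  assumes "represents w a b c" "represents w' a b c"
  shows "w' = w"
proof -
  let ?d = "\<lambda>k. digit_of ((T ^^ k) (of_int a / of_int c, of_int b / of_int c))"
  obtain n where n: "w = map ?d [0..<n + 1]" "\<forall>k<n. \<exists>i. ?d k = Idx i" "?d n \<in> {OE, EO}"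
    using represents_orbit[OF assms(1)] by metis
  obtain n' where n': "w' = map ?d [0..<n' + 1]" "\<forall>k<n'. \<exists>i. ?d k = Idx i" "?d n' \<in> {OE, EO}"
    using represents_orbit[OF assms(2)] by metis
  \<comment> \<open>Both positions are the first one whose digit is not an index.\<close>
  have "n = n'"
    using n(2,3) n'(2,3) by (metis digit.distinct(1,3) insertE linorder_neqE_nat singletonD)
  then show ?thesis using n(1) n'(1) by simp
qed

lemma ternary_expansion_orbit:
  assumes "primitive_pythagorean_triple a b c"
  defines "p \<equiv> (of_int a / of_int c, of_int b / of_int c)"
  shows "\<exists>n. (\<forall>k\<le>n. (T ^^ k) p \<in> quarter_circle) \<and> (T ^^ (n + 1)) p \<in> {(1, 0), (0, 1)} \<and>
    is_ternary_expansion (map (\<lambda>k. digit_of ((T ^^ k) p)) [0..<n + 1]) a b c"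
proof -
  obtain w where w: "represents w a b c" using ternary_word_exists[OF assms(1)] ..
  then obtain n where "\<forall>k\<le>n. (T ^^ k) p \<in> quarter_circle" "(T ^^ (n + 1)) p \<in> {(1, 0), (0, 1)}"
    "w = map (\<lambda>k. digit_of ((T ^^ k) p)) [0..<n + 1]"
    unfolding p_def by (rule represents_orbit)
  then show ?thesis
    using w represents_unique unfolding is_ternary_expansion_def by blast
qed

section \<open>Rational points\<close>

lemma lowest_terms_primitive:
  fixes a b c :: int
  assumes "(of_int a / of_int c, of_int b / of_int c) \<in> quarter_circle" "c > 0" "coprime a c"
  shows "primitive_pythagorean_triple a b c"
proof -
  have pos: "a > 0" "b > 0" and "(of_int a / of_int c)\<^sup>2 + (of_int b / of_int c)\<^sup>2 = (1::real)"
    using assms(1,2) by (auto simp: quarter_circle_def zero_less_divide_iff)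
  then have "(of_int (a\<^sup>2 + b\<^sup>2) :: real) = of_int (c\<^sup>2)"
    using assms(2) by (simp add: power_divide flip: add_divide_distrib)
  then have eq: "a\<^sup>2 + b\<^sup>2 = c\<^sup>2"
    by (simp only: of_int_eq_iff)
  have "coprime (a\<^sup>2) (a\<^sup>2 + b\<^sup>2)"
    using assms(3) by (simp add: eq)
  then have "is_unit d" if "d dvd a" "d dvd b" for d
    using that by (intro coprime_common_divisor[of "a\<^sup>2" "a\<^sup>2 + b\<^sup>2"])
      (auto simp: power2_eq_square simp del: coprime_power_left_iff)
  then have "coprime a b"
    by (rule coprimeI)
  then show ?thesis
    using pos assms(2) eq by (simp add: primitive_pythagorean_triple_def)
qed

text \<open>
  Both coordinates are first written in lowest terms separately; the equation of the circle forces
  the two denominators to divide each other.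
\<close>

lemma rational_point_lowest_terms:
  assumes "(x, y) \<in> quarter_circle" "x \<in> \<rat>" "y \<in> \<rat>"
  obtains a b c :: int where "c > 0" "coprime a c" "coprime b c"
    "x = of_int a / of_int c" "y = of_int b / of_int c"
proof -
  have lowest: "\<exists>a c :: int. c > 0 \<and> coprime a c \<and> z = of_int a / of_int c" if "z \<in> \<rat>" for z :: real
    using Rats_cases'[OF that] by metis
  obtain a c where ac: "c > 0" "coprime a c" "x = of_int a / of_int c"
    using lowest[OF assms(2)] by blast
  obtain b e where be: "e > 0" "coprime b e" "y = of_int b / of_int e"
    using lowest[OF assms(3)] by blast
  have "(of_int a / of_int c)\<^sup>2 + (of_int b / of_int e)\<^sup>2 = (1::real)"
    using assms(1) ac be by (simp add: quarter_circle_def)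
  then have "(of_int (a\<^sup>2 * e\<^sup>2 + b\<^sup>2 * c\<^sup>2) :: real) = of_int (c\<^sup>2 * e\<^sup>2)"
    using ac(1) be(1) by (simp add: field_simps)
  then have eq: "a\<^sup>2 * e\<^sup>2 + b\<^sup>2 * c\<^sup>2 = c\<^sup>2 * e\<^sup>2"
    by (simp only: of_int_eq_iff)
  have "a\<^sup>2 * e\<^sup>2 = c\<^sup>2 * (e\<^sup>2 - b\<^sup>2)" "b\<^sup>2 * c\<^sup>2 = e\<^sup>2 * (c\<^sup>2 - a\<^sup>2)"
    using eq by (simp_all add: algebra_simps)
  then have "c\<^sup>2 dvd a\<^sup>2 * e\<^sup>2" "e\<^sup>2 dvd b\<^sup>2 * c\<^sup>2" by simp_all
  then have "c\<^sup>2 dvd e\<^sup>2" "e\<^sup>2 dvd c\<^sup>2"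
    using ac(2) be(2) by (simp_all add: coprime_dvd_mult_right_iff coprime_commute)
  then have "c = e"
    using ac(1) be(1) zdvd_antisym_nonneg by simp
  then show ?thesis using that ac be by blast
qed

lemma rational_orbit_leaves_arc:
  assumes "p \<in> quarter_circle" "p \<in> \<rat> \<times> \<rat>"
  shows "\<exists>k. (T ^^ k) p \<notin> quarter_circle"
proof -
  obtain x y where p: "p = (x, y)" by (cases p)
  obtain a b c :: int where abc: "c > 0" "coprime a c" "x = of_int a / of_int c" "y = of_int b / of_int c"
    using rational_point_lowest_terms[of x y] assms unfolding p by (metis SigmaE2)
  then have "primitive_pythagorean_triple a b c"
    using lowest_terms_primitive assms(1) unfolding p by simp
  then obtain n where "(T ^^ (n + 1)) p \<in> {(1, 0), (0, 1)}"
    using ternary_expansion_orbit abc unfolding p by blast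
  then have "(T ^^ (n + 1)) p \<notin> quarter_circle" by (auto simp: quarter_circle_def)
  then show ?thesis ..
qed

section \<open>The half-angle coordinate\<close>

text \<open>
  The inverse of \<open>(x, y) \<mapsto> y / (1 + x)\<close>, that is, of the tangent of half the polar angle.
\<close>

definition arc_point :: "real \<Rightarrow> real \<times> real" where
  "arc_point u = ((1 - u\<^sup>2) / (1 + u\<^sup>2), 2 * u / (1 + u\<^sup>2))"

text \<open>
  The inverse branches of \<open>T\<close> in the half-angle coordinate.
\<close>

fun branch :: "index \<Rightarrow> real \<Rightarrow> real" where
  "branch I1 v = v / (1 + 2 * v)"
| "branch I2 v = 1 / (2 + v)"
| "branch I3 v = 1 / (2 - v)"

lemma arc_triple:
  assumes "0 < u" "u < 1"
  shows "right_triple (1 - u\<^sup>2, 2 * u, 1 + u\<^sup>2)" "arc_point u = normalise (1 - u\<^sup>2, 2 * u, 1 + u\<^sup>2)"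
proof -
  have "u\<^sup>2 < 1" using assms by (simp add: power_less_one_iff)
  then show "right_triple (1 - u\<^sup>2, 2 * u, 1 + u\<^sup>2)"
    using assms by (simp add: right_triple_def add_pos_nonneg) (simp add: power2_eq_square algebra_simps)
qed (simp add: arc_point_def normalise_def)

lemma arc_in_quarter_circle: "0 < u \<Longrightarrow> u < 1 \<Longrightarrow> arc_point u \<in> quarter_circle"
  using arc_triple[of u] normalise_in_quarter_circle by metis

lemma half_angle:
  assumes "(x, y) \<in> quarter_circle"
  shows "0 < y / (1 + x)" "y / (1 + x) < 1" "arc_point (y / (1 + x)) = (x, y)"
proof -
  have *: "x > 0" "y > 0" "x\<^sup>2 + y\<^sup>2 = 1" using assms by (auto simp: quarter_circle_def)
  then have "y\<^sup>2 < 1" by (metis less_add_same_cancel2 zero_less_power)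
  then have "y < 1" using * by (simp add: power_less_one_iff)
  then show "0 < y / (1 + x)" "y / (1 + x) < 1" using * by simp_all
  have y2: "y\<^sup>2 = (1 + x) * (1 - x)" using *(3) by (simp add: power2_eq_square algebra_simps)
  have u2: "(y / (1 + x))\<^sup>2 = (1 - x) / (1 + x)"
    unfolding power_divide y2 using *(1) by (simp add: power2_eq_square)
  show "arc_point (y / (1 + x)) = (x, y)"
    unfolding arc_point_def u2 using *(1,2) by (simp add: field_simps)
qed

lemma arc_surj:
  assumes "p \<in> quarter_circle"
  shows "\<exists>u. 0 < u \<and> u < 1 \<and> p = arc_point u"
  using half_angle[of "fst p" "snd p"] assms by (intro exI[of _ "snd p / (1 + fst p)"]) simp

lemma arc_inj:
  assumes "0 < u" "u < 1" "0 < v" "v < 1" "arc_point u = arc_point v"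
  shows "u = v"
proof -
  have "snd (arc_point w) / (1 + fst (arc_point w)) = w" if "0 < w" for w
  proof -
    have "1 + w\<^sup>2 > 0" by (simp add: add_pos_nonneg)
    then show ?thesis by (simp add: arc_point_def field_simps)
  qed
  then show ?thesis using assms by metis
qed

lemma arc_rational_iff:
  assumes "0 < u" "u < 1"
  shows "arc_point u \<in> \<rat> \<times> \<rat> \<longleftrightarrow> u \<in> \<rat>"
proof
  assume "arc_point u \<in> \<rat> \<times> \<rat>"
  then have xy: "fst (arc_point u) \<in> \<rat>" "snd (arc_point u) \<in> \<rat>" by (auto simp: mem_Times_iff)
  define v where "v = snd (arc_point u) / (1 + fst (arc_point u))"
  have "(fst (arc_point u), snd (arc_point u)) \<in> quarter_circle" using arc_in_quarter_circle[OF assms] by simp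
  note v = half_angle[OF this, folded v_def]
  have "v = u" using arc_inj[of v u] v assms by simp
  moreover have "v \<in> \<rat>" unfolding v_def using xy by simp
  ultimately show "u \<in> \<rat>" by simp
qed (simp add: arc_point_def)

lemma branch_in_unit: "0 < v \<Longrightarrow> v < 1 \<Longrightarrow> 0 < branch i v \<and> branch i v < 1"
  by (cases i) (simp_all add: field_simps)

text \<open>
  Up to the square \<open>d\<close> of the denominator of the Moebius map, the branches are the action of the three
  matrices on the parametrised cone \<open>(1 - v\<^sup>2, 2v, 1 + v\<^sup>2)\<close>. So the facts about children carry over.
\<close>

lemma arc_branch:
  assumes "0 < v" "v < 1"
  shows "T (arc_point (branch i v)) = arc_point v" "digit_of (arc_point (branch i v)) = Idx i"
proof -
  define u where "u = branch i v"
  have u: "0 < u" "u < 1" using branch_in_unit assms by (simp_all add: u_def)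
  obtain a b c where t: "child i (1 - v\<^sup>2, 2 * v, 1 + v\<^sup>2) = (a, b, c)"
    by (cases "child i (1 - v\<^sup>2, 2 * v, 1 + v\<^sup>2)")
  obtain d where d: "d > 0" "a = d * (1 - u\<^sup>2)" "b = d * (2 * u)" "c = d * (1 + u\<^sup>2)"
  proof
    let ?e = "case i of I1 \<Rightarrow> 1 + 2 * v | I2 \<Rightarrow> 2 + v | I3 \<Rightarrow> 2 - v"
    let ?n = "case i of I1 \<Rightarrow> v | I2 \<Rightarrow> 1 | I3 \<Rightarrow> 1"
    have pos: "?e > 0" using assms by (cases i) auto
    then show "?e\<^sup>2 > 0" by simp
    have n: "?n = ?e * u" using pos unfolding u_def by (cases i) auto
    have "a = ?e\<^sup>2 - ?n\<^sup>2 \<and> b = 2 * ?e * ?n \<and> c = ?e\<^sup>2 + ?n\<^sup>2"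
      using t by (cases i) (auto simp: power2_eq_square algebra_simps)
    then show "a = ?e\<^sup>2 * (1 - u\<^sup>2)" "b = ?e\<^sup>2 * (2 * u)" "c = ?e\<^sup>2 * (1 + u\<^sup>2)"
      unfolding n by (simp_all only: power2_eq_square) (simp_all only: algebra_simps)
  qed
  have "arc_point u = normalise (child i (1 - v\<^sup>2, 2 * v, 1 + v\<^sup>2))"
    using d(1) unfolding t by (simp add: arc_point_def normalise_def d(2-4))
  then show "T (arc_point (branch i v)) = arc_point v" "digit_of (arc_point (branch i v)) = Idx i"
    using T_child digit_of_child arc_triple[OF assms] by (simp_all flip: u_def)
qed

lemma branch_cases:
  assumes "0 < u" "u < 1" "u \<noteq> 1 / 3" "u \<noteq> 1 / 2"
  shows "\<exists>i v. 0 < v \<and> v < 1 \<and> u = branch i v"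
proof -
  consider "u < 1 / 3" | "1 / 3 < u" "u < 1 / 2" | "1 / 2 < u" using assms by linarith
  then show ?thesis
  proof cases
    case 1
    then show ?thesis using assms by (intro exI[of _ I1] exI[of _ "u / (1 - 2 * u)"]) (simp add: field_simps)
  next
    case 2
    then show ?thesis using assms by (intro exI[of _ I2] exI[of _ "1 / u - 2"]) (simp add: field_simps)
  next
    case 3
    then show ?thesis using assms by (intro exI[of _ I3] exI[of _ "2 - 1 / u"]) (simp add: field_simps)
  qed
qed

section \<open>Itineraries\<close>

text \<open>
  The sequence \<open>u\<close> is the orbit in the half-angle coordinate, but the relation between consecutive
  terms is stated with the inverse branches: \<open>s\<close> then determines every step, and no case distinction
  on the position of \<open>u k\<close> is needed.
\<close>

definition itinerary :: "(nat \<Rightarrow> index) \<Rightarrow> (nat \<Rightarrow> real) \<Rightarrow> bool" where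
  "itinerary s u \<longleftrightarrow> (\<forall>k. 0 < u k \<and> u k < 1 \<and> u k = branch (s k) (u (Suc k)))"

lemma itineraryD:
  assumes "itinerary s u"
  shows "0 < u k" "u k < 1" "u k = branch (s k) (u (Suc k))"
  using assms unfolding itinerary_def by blast+

lemma itinerary_orbit:
  assumes "itinerary s u"
  shows "(T ^^ k) (arc_point (u 0)) = arc_point (u k)" "(T ^^ k) (arc_point (u 0)) \<in> quarter_circle"
    "digit_of ((T ^^ k) (arc_point (u 0))) = Idx (s k)"
proof -
  note u = itineraryD[OF assms]
  have step: "T (arc_point (u k)) = arc_point (u (Suc k))" "digit_of (arc_point (u k)) = Idx (s k)" for k
    using arc_branch[of "u (Suc k)" "s k"] u(1,2) by (simp_all flip: u(3))
  show iter: "(T ^^ k) (arc_point (u 0)) = arc_point (u k)" by (induction k) (simp_all add: step)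
  show "(T ^^ k) (arc_point (u 0)) \<in> quarter_circle" "digit_of ((T ^^ k) (arc_point (u 0))) = Idx (s k)"
    unfolding iter using step arc_in_quarter_circle u(1,2) by simp_all
qed

lemma orbit_itinerary:
  assumes "\<forall>k. (T ^^ k) p \<in> quarter_circle \<and> digit_of ((T ^^ k) p) = Idx (s k)"
  obtains u where "itinerary s u" "p = arc_point (u 0)"
proof -
  have "\<forall>k. \<exists>u. 0 < u \<and> u < 1 \<and> (T ^^ k) p = arc_point u"
    using assms arc_surj by blast
  then obtain u where u: "0 < u k" "u k < 1" "(T ^^ k) p = arc_point (u k)" for k
    by metis
  have "u k = branch (s k) (u (Suc k))" for k
  proof -
    have d: "digit_of (arc_point (u k)) = Idx (s k)" using assms u by metis
    moreover have "digit_of (arc_point (1 / 3)) = EO" "digit_of (arc_point (1 / 2)) = OE"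
      by (simp_all add: arc_point_def digit_of_def power2_eq_square)
    ultimately have "u k \<noteq> 1 / 3" "u k \<noteq> 1 / 2"
      by (metis digit.distinct)+
    then obtain i v where v: "0 < v" "v < 1" "u k = branch i v"
      using branch_cases u(1,2) by blast
    have "i = s k" using arc_branch(2)[OF v(1,2), of i] d v by simp
    moreover have "arc_point v = arc_point (u (Suc k))"
      using arc_branch(1)[OF v(1,2), of i] u(3)[of k] u(3)[of "Suc k"] v by simp
    then have "v = u (Suc k)" using arc_inj u v by blast
    ultimately show ?thesis using v(3) by simp
  qed
  then have "itinerary s u" using u(1,2) unfolding itinerary_def by blast
  then show ?thesis using that u(3)[of 0] by simp
qed

lemma itinerary_irrational:
  assumes "itinerary s u"
  shows "u 0 \<notin> \<rat>"
proof -
  note u = itineraryD(1,2)[OF assms, of 0]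
  have "\<nexists>k. (T ^^ k) (arc_point (u 0)) \<notin> quarter_circle"
    using itinerary_orbit(2)[OF assms] by simp
  then have "arc_point (u 0) \<notin> \<rat> \<times> \<rat>"
    using rational_orbit_leaves_arc arc_in_quarter_circle[OF u] by metis
  then show ?thesis using arc_rational_iff[OF u] by simp
qed

lemma no_unit_descent:
  fixes f :: "nat \<Rightarrow> real"
  assumes "\<And>k. k \<ge> N \<Longrightarrow> f (Suc k) \<le> f k - 1" "\<And>k. f k > 0"
  shows False
proof -
  have "f (N + n) \<le> f N - n" for n
  proof (induction n)
    case (Suc n)
    then show ?case using assms(1)[of "N + n"] by simp
  qed simp
  moreover obtain n :: nat where "f N < n" using reals_Archimedean2 by blast
  ultimately show False using assms(2)[of "N + n"] by (meson diff_gt_0_iff_gt less_le_trans not_less_iff_gr_or_eq)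
qed

text \<open>
  In the coordinates \<open>1 / u\<close> and \<open>1 / (1 - u)\<close>, which send the neutral fixed point of the branch to
  infinity, going forward along digit 1 or digit 3 subtracts 2 or 1.
\<close>

lemma itinerary_not_ends_in:
  assumes "itinerary s u"
  shows "\<not> ends_in I1 s" "\<not> ends_in I3 s"
proof -
  note u = itineraryD[OF assms]
  show "\<not> ends_in I1 s"
  proof
    assume "ends_in I1 s"
    then obtain N where N: "s k = I1" if "k \<ge> N" for k by (auto simp: ends_in_def)
    have "1 / u (Suc k) \<le> 1 / u k - 1" if "k \<ge> N" for k
    proof -
      have "1 / u k = (1 + 2 * u (Suc k)) / u (Suc k)"
        using u(3)[of k] N[OF that] by simp
      also have "\<dots> = 1 / u (Suc k) + 2" using u(1)[of "Suc k"] by (simp add: field_simps)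
      finally show ?thesis by simp
    qed
    moreover have "1 / u k > 0" for k using u(1)[of k] by simp
    ultimately show False by (rule no_unit_descent)
  qed
  show "\<not> ends_in I3 s"
  proof
    assume "ends_in I3 s"
    then obtain N where N: "s k = I3" if "k \<ge> N" for k by (auto simp: ends_in_def)
    have "1 / (1 - u (Suc k)) \<le> 1 / (1 - u k) - 1" if "k \<ge> N" for k
    proof -
      have v: "u (Suc k) < 1" by (rule u)
      have "u k = 1 / (2 - u (Suc k))" using u(3)[of k] N[OF that] by simp
      then have "1 - u k = (1 - u (Suc k)) / (2 - u (Suc k))" using v by (simp add: field_simps)
      then have "1 / (1 - u k) = (2 - u (Suc k)) / (1 - u (Suc k))" by simp
      also have "\<dots> = 1 / (1 - u (Suc k)) + 1" using v by (simp add: field_simps)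
      finally show ?thesis by simp
    qed
    moreover have "1 / (1 - u k) > 0" for k using u(2)[of k] by simp
    ultimately show False by (rule no_unit_descent)
  qed
qed

text \<open>
  Irrationality keeps the orbit away from \<open>1/3\<close> and \<open>1/2\<close>, the only points outside the images of
  the open unit interval under the branches, and it is inherited because the branches have
  rational coefficients.
\<close>

lemma irrational_itinerary:
  assumes "0 < x" "x < 1" "x \<notin> \<rat>"
  obtains s u where "itinerary s u" "u 0 = x"
proof -
  let ?P = "\<lambda>(k::nat) v. 0 < v \<and> v < 1 \<and> v \<notin> \<rat> \<and> (k = 0 \<longrightarrow> v = x)"
  have "\<exists>u. \<forall>k. ?P k (u k) \<and> (\<exists>i. u k = branch i (u (Suc k)))"
  proof (rule dependent_nat_choice)
    show "\<exists>v. ?P 0 v" using assms by blast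
    fix v k assume v: "?P k v"
    moreover have "(1 / 3 :: real) \<in> \<rat>" "(1 / 2 :: real) \<in> \<rat>" by simp_all
    ultimately have "v \<noteq> 1 / 3" "v \<noteq> 1 / 2" by metis+
    then obtain i v' where v': "0 < v'" "v' < 1" "v = branch i v'"
      using branch_cases v by blast
    have "v' \<notin> \<rat>" using v v' by (cases i) auto
    then show "\<exists>v'. ?P (Suc k) v' \<and> (\<exists>i. v = branch i v')" using v' by blast
  qed
  then obtain u where u: "?P k (u k)" "\<exists>i. u k = branch i (u (Suc k))" for k by blast
  then obtain s where "u k = branch (s k) (u (Suc k))" for k by metis
  then have "itinerary s u" using u(1) unfolding itinerary_def by blast
  then show ?thesis using that u(1)[of 0] by blast
qed

text \<open>
  Each branch is a homeomorphism onto its image; the second disjunct occurs because the branch of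
  digit 2 reverses the order.
\<close>

lemma branch_between:
  assumes "0 < v" "v < 1" "0 < w" "w < 1" "branch i v < r" "r < branch i w"
  shows "\<exists>r'. r = branch i r' \<and> (v < r' \<and> r' < w \<or> w < r' \<and> r' < v)"
proof (cases i)
  case I1
  have "0 < branch i v" using assms I1 by simp
  moreover have "branch i w < 1 / 2" using assms I1 by (simp add: field_simps)
  ultimately have "0 < r" "r < 1 / 2" using assms(5,6) by linarith+
  then show ?thesis using assms I1 by (intro exI[of _ "r / (1 - 2 * r)"]) (simp add: field_simps)
next
  case I2
  have "0 < branch i v" using assms I2 by simp
  then have "0 < r" using assms(5) by linarith
  then show ?thesis using assms I2 by (intro exI[of _ "1 / r - 2"]) (simp add: field_simps)
next
  case I3
  have "0 < branch i v" using assms I3 by simp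
  then have "0 < r" using assms(5) by linarith
  then show ?thesis using assms I3 by (intro exI[of _ "2 - 1 / r"]) (simp add: field_simps)
qed

lemma itinerary_unique:
  assumes "itinerary s u" "itinerary s v"
  shows "u 0 = v 0"
proof (rule ccontr)
  assume "u 0 \<noteq> v 0"
  \<comment> \<open>A rational number between the starting points is followed forward; it stays between the
    two itineraries and so gets the digits \<open>s\<close> itself.\<close>
  let ?P = "\<lambda>(k::nat) r. (u k < r \<and> r < v k \<or> v k < r \<and> r < u k) \<and> (k = 0 \<longrightarrow> r \<in> \<rat>)"
  note u = itineraryD[OF assms(1)] and v = itineraryD[OF assms(2)]
  have "\<exists>r. \<forall>k. ?P k (r k) \<and> r k = branch (s k) (r (Suc k))"
  proof (rule dependent_nat_choice)
    show "\<exists>r. ?P 0 r"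
      using \<open>u 0 \<noteq> v 0\<close> Rats_dense_in_real by (metis linorder_neqE)
    fix r k assume r: "?P k r"
    show "\<exists>r'. ?P (Suc k) r' \<and> r = branch (s k) r'"
    proof -
      have "branch (s k) (u (Suc k)) < r \<and> r < branch (s k) (v (Suc k)) \<or>
          branch (s k) (v (Suc k)) < r \<and> r < branch (s k) (u (Suc k))"
        using r by (simp flip: u(3) v(3))
      then obtain r' where "r = branch (s k) r'"
        "u (Suc k) < r' \<and> r' < v (Suc k) \<or> v (Suc k) < r' \<and> r' < u (Suc k)"
        using branch_between[OF u(1,2) v(1,2)] branch_between[OF v(1,2) u(1,2)] by blast
      then show ?thesis by (intro exI[of _ r']) simp
    qed
  qed
  then obtain r where r: "?P k (r k)" "r k = branch (s k) (r (Suc k))" for k by blast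
  have "0 < r k \<and> r k < 1" for k
    using r(1)[of k] u(1,2)[of k] v(1,2)[of k] by linarith
  then have "itinerary s r" using r(2) unfolding itinerary_def by blast
  then show False using itinerary_irrational r(1)[of 0] by blast
qed

text \<open>
  The closed interval of all points whose first \<open>n\<close> digits may be taken to be those of \<open>s\<close>, with
  common end points counted on both sides.
\<close>

fun cylinder :: "nat \<Rightarrow> (nat \<Rightarrow> index) \<Rightarrow> real set" where
  "cylinder 0 s = {0..1}"
| "cylinder (Suc n) s = branch (s 0) ` cylinder n (\<lambda>k. s (Suc k))"

lemma cylinder_subset_unit: "cylinder n s \<subseteq> {0..1}"
proof (induction n arbitrary: s)
  case (Suc n)
  have "branch i ` {0..1} \<subseteq> {0..1}" for i by (cases i) (auto simp: field_simps)
  then show ?case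
    unfolding cylinder.simps using Suc by (meson image_mono order_trans)
qed simp

lemma cylinder_decreasing: "cylinder (Suc n) s \<subseteq> cylinder n s"
proof (induction n arbitrary: s)
  case 0
  then show ?case using cylinder_subset_unit[of "Suc 0" s] by simp
next
  case (Suc n)
  then show ?case by (subst (1 2) cylinder.simps) (rule image_mono)
qed

lemma cylinder_compact: "compact (cylinder n s)"
proof (induction n arbitrary: s)
  case (Suc n)
  have "continuous_on {0..1} (branch i)" for i
    by (cases i) (auto intro!: continuous_intros)
  then show ?case
    unfolding cylinder.simps
    by (intro compact_continuous_image[OF continuous_on_subset[OF _ cylinder_subset_unit] Suc])
qed simp

lemma cylinder_nonempty: "cylinder n s \<noteq> {}"
  by (induction n arbitrary: s) auto

lemma branch_inj: "inj_on (branch i) {0..1}"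
  by (cases i) (auto simp: inj_on_def field_simps)

text \<open>
  A point in all cylinders of \<open>s\<close> has its preimage under the first branch in all cylinders of the
  shifted sequence. The preimage might depend on the depth of the cylinder; injectivity of the branch
  rules this out.
\<close>

lemma closed_itinerary_exists:
  obtains u where "\<And>k. 0 \<le> u k \<and> u k \<le> 1 \<and> u k = branch (s k) (u (Suc k))"
proof -
  let ?C = "\<lambda>s. \<Inter>n. cylinder n s"
  have ne: "?C s \<noteq> {}" for s
    by (rule compact_nest[OF cylinder_compact cylinder_nonempty])
      (rule lift_Suc_antimono_le[of "\<lambda>n. cylinder n s", OF cylinder_decreasing])
  have step: "\<exists>v. v \<in> ?C (\<lambda>k. s (Suc k)) \<and> x = branch (s 0) v" if x: "x \<in> ?C s" for s x
  proof -
    have "\<forall>n. \<exists>v. v \<in> cylinder n (\<lambda>k. s (Suc k)) \<and> x = branch (s 0) v"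
      using x by (metis INT_iff UNIV_I cylinder.simps(2) imageE)
    then obtain v where v: "v n \<in> cylinder n (\<lambda>k. s (Suc k))" "x = branch (s 0) (v n)" for n
      by metis
    have "v n = v 0" for n
      using branch_inj[of "s 0"] v cylinder_subset_unit by (metis inj_onD subsetD)
    then show ?thesis using v by (metis INT_I)
  qed
  have "\<exists>u. \<forall>k. u k \<in> ?C (\<lambda>j. s (k + j)) \<and> u k = branch (s k) (u (Suc k))"
  proof (rule dependent_nat_choice)
    show "\<exists>x. x \<in> ?C (\<lambda>j. s (0 + j))" using ne by blast
    fix x k assume "x \<in> ?C (\<lambda>j. s (k + j))"
    then show "\<exists>y. y \<in> ?C (\<lambda>j. s (Suc k + j)) \<and> x = branch (s k) y"
      using step[of x "\<lambda>j. s (k + j)"] by simp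
  qed
  then obtain u where u: "u k \<in> ?C (\<lambda>j. s (k + j))" "u k = branch (s k) (u (Suc k))" for k by blast
  have "u k \<in> {0..1}" for k using u(1)[of k] cylinder_subset_unit by blast
  then have "0 \<le> u k \<and> u k \<le> 1 \<and> u k = branch (s k) (u (Suc k))" for k
    using u(2)[of k] by (metis atLeastAtMost_iff)
  then show ?thesis by (rule that)
qed

text \<open>
  On the closed interval, the value 0 is taken only by the branch of digit 1 and only at 0, the
  value 1 only by the branch of digit 3 and only at 1. So an itinerary that reaches an end point stays
  there, with a constant digit.
\<close>

lemma itinerary_exists:
  assumes "\<not> ends_in I1 s" "\<not> ends_in I3 s"
  obtains u where "itinerary s u"
proof -
  obtain u where u: "0 \<le> u k \<and> u k \<le> 1 \<and> u k = branch (s k) (u (Suc k))" for k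
    using closed_itinerary_exists by blast
  have zero: "s k = I1 \<and> u (Suc k) = 0" if "u k = 0" for k
  proof -
    have "branch (s k) (u (Suc k)) = 0" "0 \<le> u (Suc k)" "u (Suc k) \<le> 1"
      using u[of k] u[of "Suc k"] that by metis+
    then show ?thesis by (cases "s k") auto
  qed
  have one: "s k = I3 \<and> u (Suc k) = 1" if "u k = 1" for k
  proof -
    have "branch (s k) (u (Suc k)) = 1" "0 \<le> u (Suc k)" "u (Suc k) \<le> 1"
      using u[of k] u[of "Suc k"] that by metis+
    then show ?thesis by (cases "s k") (auto simp: field_simps)
  qed
  have "u k \<noteq> 0" for k
  proof
    assume "u k = 0"
    have "u j = 0" if "j \<ge> k" for j
      using that
    proof (induction j rule: dec_induct)
      case base
      show ?case by fact
    next
      case (step j)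
      show ?case using zero[OF step.IH] by (rule conjunct2)
    qed
    then show False using assms(1) zero unfolding ends_in_def by blast
  qed
  moreover have "u k \<noteq> 1" for k
  proof
    assume "u k = 1"
    have "u j = 1" if "j \<ge> k" for j
      using that
    proof (induction j rule: dec_induct)
      case base
      show ?case by fact
    next
      case (step j)
      show ?case using one[OF step.IH] by (rule conjunct2)
    qed
    then show False using assms(2) one unfolding ends_in_def by blast
  qed
  ultimately have "0 < u k \<and> u k < 1" for k
    using u[of k] unfolding less_le by metis
  then have "itinerary s u"
    using u unfolding itinerary_def by blast
  then show ?thesis by (rule that)
qed

theorem theorem2:
  shows
    "(\<forall>x y. (x, y) \<in> quarter_circle \<inter> (\<rat> \<times> \<rat>) \<longrightarrow>
        (\<exists>a b c :: int. c > 0 \<and> coprime a c \<and> coprime b c \<and>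
            x = of_int a / of_int c \<and> y = of_int b / of_int c) \<and>
        (\<forall>a b c :: int. c > 0 \<and> coprime a c \<and> coprime b c \<and>
            x = of_int a / of_int c \<and> y = of_int b / of_int c \<longrightarrow>
          primitive_pythagorean_triple a b c \<and>
          (\<exists>n. (\<forall>k\<le>n. (T ^^ k) (x, y) \<in> quarter_circle) \<and>
               (T ^^ (n + 1)) (x, y) \<in> {(1, 0), (0, 1)} \<and>
               is_ternary_expansion (map (\<lambda>k. digit_of ((T ^^ k) (x, y))) [0..<n + 1]) a b c)))
     \<and>
     (\<forall>p. p \<in> quarter_circle \<and> p \<notin> \<rat> \<times> \<rat> \<longrightarrow>
        (\<forall>k. (T ^^ k) p \<in> quarter_circle) \<and>
        (\<exists>s :: nat \<Rightarrow> index. (\<forall>k. digit_of ((T ^^ k) p) = Idx (s k)) \<and>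
           \<not> ends_in I1 s \<and> \<not> ends_in I3 s))
     \<and>
     (\<forall>s :: nat \<Rightarrow> index. \<not> ends_in I1 s \<and> \<not> ends_in I3 s \<longrightarrow>
        (\<exists>!p. p \<in> quarter_circle \<and>
           (\<forall>k. (T ^^ k) p \<in> quarter_circle \<and> digit_of ((T ^^ k) p) = Idx (s k))) \<and>
        (\<forall>p. p \<in> quarter_circle \<and>
           (\<forall>k. (T ^^ k) p \<in> quarter_circle \<and> digit_of ((T ^^ k) p) = Idx (s k)) \<longrightarrow>
           p \<notin> \<rat> \<times> \<rat>))"
proof (intro conjI allI impI)
  fix x y :: real
  assume "(x, y) \<in> quarter_circle \<inter> (\<rat> \<times> \<rat>)"
  then show "\<exists>a b c :: int. c > 0 \<and> coprime a c \<and> coprime b c \<and>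
      x = of_int a / of_int c \<and> y = of_int b / of_int c"
    using rational_point_lowest_terms[of x y] by (metis IntD1 IntD2 SigmaE2)
next
  fix x y :: real and a b c :: int
  assume "(x, y) \<in> quarter_circle \<inter> (\<rat> \<times> \<rat>)"
    and "c > 0 \<and> coprime a c \<and> coprime b c \<and> x = of_int a / of_int c \<and> y = of_int b / of_int c"
  then show ppt: "primitive_pythagorean_triple a b c"
    using lowest_terms_primitive by blast
  then show "\<exists>n. (\<forall>k\<le>n. (T ^^ k) (x, y) \<in> quarter_circle) \<and>
      (T ^^ (n + 1)) (x, y) \<in> {(1, 0), (0, 1)} \<and>
      is_ternary_expansion (map (\<lambda>k. digit_of ((T ^^ k) (x, y))) [0..<n + 1]) a b c"
    using ternary_expansion_orbit \<open>c > 0 \<and> _\<close> by blast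
next
  fix p :: "real \<times> real"
  assume p: "p \<in> quarter_circle \<and> p \<notin> \<rat> \<times> \<rat>"
  then obtain x where x: "0 < x" "x < 1" "p = arc_point x" using arc_surj by blast
  then have "x \<notin> \<rat>" using p arc_rational_iff by blast
  then obtain s u where su: "itinerary s u" "u 0 = x" using irrational_itinerary x by metis
  note orbit = itinerary_orbit[OF su(1), unfolded su(2), folded x(3)]
  show "(T ^^ k) p \<in> quarter_circle" for k by (rule orbit)
  show "\<exists>s :: nat \<Rightarrow> index. (\<forall>k. digit_of ((T ^^ k) p) = Idx (s k)) \<and>
      \<not> ends_in I1 s \<and> \<not> ends_in I3 s"
    using orbit itinerary_not_ends_in[OF su(1)] by blast
next
  fix s :: "nat \<Rightarrow> index"
  assume s: "\<not> ends_in I1 s \<and> \<not> ends_in I3 s"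
  let ?coded = "\<lambda>p. p \<in> quarter_circle \<and>
    (\<forall>k. (T ^^ k) p \<in> quarter_circle \<and> digit_of ((T ^^ k) p) = Idx (s k))"
  obtain u where u: "itinerary s u" using itinerary_exists s by blast
  show "\<exists>!p. ?coded p"
  proof (rule ex1I)
    show "?coded (arc_point (u 0))"
      using itinerary_orbit[OF u] itinerary_orbit(2)[OF u, of 0] by simp
    fix q assume "?coded q"
    then obtain v where "itinerary s v" "q = arc_point (v 0)" using orbit_itinerary by blast
    then show "q = arc_point (u 0)" using itinerary_unique u by metis
  qed
  show "p \<notin> \<rat> \<times> \<rat>" if "?coded p" for p
    using that rational_orbit_leaves_arc by blast
qed

end
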